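(* The following statements hold. (a) For a positive integer $q$, there exists a field with exactly $q$ elements if and only if $q = p^r$ for some prime $p$ and some integer $r \ge 1$. (b) Any two finite fields of the same cardinality are isomorphic (as fields). (c) For any finite field $\mathbb{F}$ with $|\mathbb{F}| = p^r$, where $p$ is prime and $r \ge 1$ is an integer: (i) the additive group $(\mathbb{F}, +)$ is isomorphic to the group $((\mathbb{Z}_p)^r, +)$; and (ii) the multiplicative group $(\mathbb{F} \setminus \{0\}, \cdot)$ is cyclic.
   Context: Here $\mathbb{Z}_p$ denotes the ring of integers modulo $p$ (a field, since $p$ is prime), and $(\mathbb{Z}_p)^r$ is the direct product of $r$ copies of its additive group. All fields are commutative. *)

theory Defs
  imports "HOL-Algebra.Algebra" "HOL-Number_Theory.Residues"
begin

text \<open>The additive group of the \<open>r\<close>-fold power of the integers modulo \<open>p\<close>. Elements are functions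
  on \<open>{..<r}\<close> with values in \<open>{0..int p - 1}\<close>, \<open>undefined\<close> outside \<open>{..<r}\<close>, so that distinct
  elements differ at some index below \<open>r\<close>.\<close>

definition Zp_power :: "nat \<Rightarrow> nat \<Rightarrow> (nat \<Rightarrow> int) monoid"
  where "Zp_power p r = product_group {..<r} (\<lambda>_. add_monoid (residue_ring (int p)))"

end

theory Submission
  imports Defs
begin

text \<open>Let \<open>F\<close> be a finite field. The additive order \<open>p\<close> of \<open>1\<close> is prime because \<open>F\<close> has no zero
divisors, so the integers modulo \<open>p\<close> embed into \<open>F\<close>, and \<open>F\<close> is a vector space of some finite
dimension \<open>n\<close> over them. Coordinates with respect to a basis identify \<open>(F, +)\<close> with the \<open>n\<close>-fold
power of the integers modulo \<open>p\<close> (\<open>finite_field_structure\<close>). This gives the additive structure, and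
counting gives \<open>|F| = p ^ n\<close>. The multiplicative group is
cyclic because, for each \<open>d\<close>, the equation \<open>x ^ d = 1\<close> has at most \<open>d\<close> solutions.

Existence. Put \<open>q = p ^ r\<close> and let \<open>L\<close> be an algebraic closure of the integers modulo \<open>p\<close>. The solutions
of \<open>x ^ q = x\<close> in \<open>L\<close> form a subfield, since \<open>x \<mapsto> x ^ q\<close> is additive in characteristic \<open>p\<close>
(\<open>frobenius_fixed_subfield\<close>). There are exactly \<open>q\<close> of them: \<open>X ^ q - X\<close> splits over \<open>L\<close> and has no
multiple root (\<open>alg_mult_fixpoly\<close>). An injection moves this subfield into the natural numbers.

Uniqueness. Let \<open>F\<close> and \<open>K\<close> both have \<open>q = p ^ n\<close> elements, and let \<open>a\<close> generate the multiplicative group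
of \<open>F\<close>. Evaluation at \<open>a\<close> maps the polynomials over the integers modulo \<open>p\<close> onto \<open>F\<close>; its kernel is
generated by one polynomial \<open>m\<close>, which divides \<open>X ^ q - X\<close> because \<open>a ^ q = a\<close>. Every element of \<open>K\<close> is a
root of \<open>X ^ q - X\<close>, and the cofactor of \<open>m\<close> has too small a degree to vanish on all of \<open>K\<close>. So \<open>m\<close>
has a root \<open>b\<close> in \<open>K\<close>, and evaluation at \<open>b\<close> factors through evaluation at \<open>a\<close>
(\<open>finite_fields_hom\<close>). The resulting homomorphism \<open>F \<rightarrow> K\<close> is injective because \<open>F\<close> is a field, hence
bijective because the cardinalities agree.\<close>

section \<open>The prime subfield\<close>

lemma add_monoid_pow: "x [^]\<^bsub>add_monoid R\<^esub> n = add_pow R n x"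
  by (simp add: add_pow_def)

context domain
begin

text \<open>Multiples of \<open>1\<close> multiply like integers, so a proper factorization of their additive
  period \<open>p\<close> would give zero divisors. The equivalence is stated for
  integers, as it makes reduction modulo \<open>p\<close> compatible with taking multiples.\<close>
lemma finite_domain_characteristic:
  assumes fin: "finite (carrier R)"
  obtains p :: nat where "normalization_semidom_class.prime p"
    and "\<And>n::int. add_pow R n \<one> = \<zero> \<longleftrightarrow> int p dvd n"
proof -
  define p where "p = group.ord (add_monoid R) \<one>"
  have nat: "add_pow R n \<one> = \<zero> \<longleftrightarrow> p dvd n" for n :: nat
    using group.pow_eq_id[OF a_group, of \<one> n] unfolding p_def add_monoid_pow by simp
  have int: "add_pow R n \<one> = \<zero> \<longleftrightarrow> int p dvd n" for n :: int
    using group.int_pow_eq_id[OF a_group, of \<one> n] unfolding p_def add_monoid_pow by simp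
  have "prime_elem p"
    unfolding prime_elem_def
  proof (intro conjI allI impI)
    show "p \<noteq> 0"
      using group.ord_ge_1[OF a_group, of \<one>] fin by (simp add: p_def)
    show "\<not> is_unit p"
      using nat[of 1] by simp
    fix a b :: nat
    assume "p dvd a * b"
    hence "add_pow R (a * b) \<one> = \<zero>"
      by (simp add: nat)
    moreover have "add_pow R (a * b) \<one> = (add_pow R a \<one>) \<otimes> (add_pow R b \<one>)"
      by (simp add: add_pow_ldistr add.nat_pow_pow mult.commute)
    ultimately have "add_pow R a \<one> = \<zero> \<or> add_pow R b \<one> = \<zero>"
      using integral by simp
    thus "p dvd a \<or> p dvd b"
      by (simp add: nat)
  qed
  hence "normalization_semidom_class.prime p"
    by simp
  thus thesis
    using int by (rule that)
qed

end

lemma (in field) finite_field_prime_hom: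
  assumes fin: "finite (carrier R)"
  obtains p :: nat and h where "normalization_semidom_class.prime p"
    and "h \<in> ring_hom (residue_ring (int p)) R"
proof -
  obtain p :: nat where p: "normalization_semidom_class.prime p"
    and int: "\<And>n::int. add_pow R n \<one> = \<zero> \<longleftrightarrow> int p dvd n"
    using finite_domain_characteristic[OF fin] by blast
  have mod: "add_pow R (n mod int p) \<one> = add_pow R n \<one>" for n :: int
  proof -
    have "add_pow R n \<one> = add_pow R ((n div int p * int p) + n mod int p) \<one>"
      by simp
    also have "\<dots> = add_pow R (n div int p * int p) \<one> \<oplus> add_pow R (n mod int p) \<one>"
      by (subst add.int_pow_mult) auto
    also have "add_pow R (n div int p * int p) \<one> = \<zero>"
      using int by simp
    finally show ?thesis
      by simp
  qed
  have "(\<lambda>k. add_pow R k \<one>) \<in> ring_hom (residue_ring (int p)) R"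
  proof (rule ring_hom_memI)
    fix a b assume "a \<in> carrier (residue_ring (int p))" "b \<in> carrier (residue_ring (int p))"
    show "add_pow R a \<one> \<in> carrier R" by simp
    show "add_pow R (a \<oplus>\<^bsub>residue_ring (int p)\<^esub> b) \<one> = add_pow R a \<one> \<oplus> add_pow R b \<one>"
      by (simp add: residue_ring_def mod add.int_pow_mult)
    show "add_pow R (a \<otimes>\<^bsub>residue_ring (int p)\<^esub> b) \<one> = (add_pow R a \<one>) \<otimes> (add_pow R b \<one>)"
      by (simp add: residue_ring_def mod add_pow_ldistr_int add.int_pow_pow mult.commute)
  next
    show "add_pow R (\<one>\<^bsub>residue_ring (int p)\<^esub>) \<one> = \<one>"
      by (simp add: residue_ring_def)
  qed
  thus thesis
    using that p by blast
qed

lemma field_residue_ring: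
  "normalization_semidom_class.prime (p::nat) \<Longrightarrow> field (residue_ring (int p))"
  by (rule residues_prime.is_field[OF residues_prime.intro])

section \<open>Coordinates over the prime subfield\<close>

lemma card_Zp_power: "card (carrier (Zp_power p n)) = p ^ n"
  by (simp add: Zp_power_def residue_ring_def card_PiE)

text \<open>The isomorphism sends a tuple of residues to the corresponding linear combination of
  the basis; uniqueness of coordinates makes it bijective.\<close>
lemma (in ring) coordinates_iso:
  assumes h: "h \<in> ring_hom (residue_ring (int p)) R" "inj_on h (carrier (residue_ring (int p)))"
    and sub: "subfield (h ` carrier (residue_ring (int p))) R"
    and ind: "independent (h ` carrier (residue_ring (int p))) Us"
    and Span: "Span (h ` carrier (residue_ring (int p))) Us = carrier R"
  shows "Zp_power p (length Us) \<cong> add_monoid R"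
proof -
  let ?Z = "residue_ring (int p)" and ?n = "length Us"
  let ?G = "Zp_power p ?n"
  define c where "c f = map (\<lambda>i. h (f i)) [0..<?n]" for f :: "nat \<Rightarrow> int"
  have Us: "set Us \<subseteq> carrier R"
    using independent_in_carrier[OF ind] .
  have car: "carrier ?G = (\<Pi>\<^sub>E i\<in>{..<?n}. carrier ?Z)"
    by (simp add: Zp_power_def)
  have c_in: "set (c f) \<subseteq> h ` carrier ?Z" "set (c f) \<subseteq> carrier R" if "f \<in> carrier ?G" for f
    using that ring_hom_memE(1)[OF h(1)] unfolding c_def car by (auto simp: PiE_iff)
  have uniq: "\<exists>!Ks. set Ks \<subseteq> h ` carrier ?Z \<and> length Ks = ?n \<and> a = combine Ks Us"
    if "a \<in> carrier R" for a
    using unique_decomposition[OF sub ind] that Span by simp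
  have "(\<lambda>f. combine (c f) Us) \<in> hom ?G (add_monoid R)"
  proof (rule homI)
    fix f g assume f: "f \<in> carrier ?G" and g: "g \<in> carrier ?G"
    have "f i \<in> carrier ?Z \<and> g i \<in> carrier ?Z" if "i < ?n" for i
      using f g that by (auto simp: car PiE_iff)
    hence "c (f \<otimes>\<^bsub>?G\<^esub> g) = map2 (\<oplus>) (c f) (c g)"
      unfolding c_def
      by (intro nth_equalityI) (auto simp: Zp_power_def ring_hom_memE(3)[OF h(1)])
    thus "combine (c (f \<otimes>\<^bsub>?G\<^esub> g)) Us = combine (c f) Us \<otimes>\<^bsub>add_monoid R\<^esub> combine (c g) Us"
      using combine_add[of "c f" Us "c g"] c_in[OF f] c_in[OF g] Us by (simp add: c_def)
  qed (use c_in Us in auto)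
  moreover have "bij_betw (\<lambda>f. combine (c f) Us) (carrier ?G) (carrier R)"
  proof (rule bij_betw_imageI)
    show "inj_on (\<lambda>f. combine (c f) Us) (carrier ?G)"
    proof (rule inj_onI)
      fix f g assume f: "f \<in> carrier ?G" and g: "g \<in> carrier ?G"
        and eq: "combine (c f) Us = combine (c g) Us"
      have "combine (c f) Us \<in> carrier R"
        using c_in(2)[OF f] Us by simp
      moreover have "length (c f) = ?n" "length (c g) = ?n"
        by (simp_all add: c_def)
      ultimately have cfg: "c f = c g"
        using uniq c_in(1)[OF f] c_in(1)[OF g] eq by blast
      have "f i = g i" if "i < ?n" for i
      proof (rule inj_onD[OF h(2)])
        show "h (f i) = h (g i)"
          using arg_cong[OF cfg, of "\<lambda>l. l ! i"] that by (simp add: c_def)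
        show "f i \<in> carrier ?Z" "g i \<in> carrier ?Z"
          using f g that unfolding car by auto
      qed
      thus "f = g"
        using f g unfolding car by (intro PiE_ext) auto
    qed
    show "(\<lambda>f. combine (c f) Us) ` carrier ?G = carrier R"
    proof
      show "carrier R \<subseteq> (\<lambda>f. combine (c f) Us) ` carrier ?G"
      proof
        fix a assume "a \<in> carrier R"
        from uniq[OF this] obtain Ks where Ks: "set Ks \<subseteq> h ` carrier ?Z" "length Ks = ?n"
          "a = combine Ks Us" by blast
        define f where "f = (\<lambda>i\<in>{..<?n}. inv_into (carrier ?Z) h (Ks ! i))"
        have in_img: "Ks ! i \<in> h ` carrier ?Z" if "i < ?n" for i
          using Ks that nth_mem by (metis subsetD)
        have f: "f \<in> carrier ?G"
          using inv_into_into[OF in_img] by (auto simp: f_def car)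
        have "c f = Ks"
          using Ks(2) f_inv_into_f[OF in_img]
          by (intro nth_equalityI) (auto simp: c_def f_def)
        thus "a \<in> (\<lambda>f. combine (c f) Us) ` carrier ?G"
          using f Ks(3) by blast
      qed
    qed (use c_in Us in auto)
  qed
  ultimately show ?thesis
    by (auto simp: is_iso_def iso_def)
qed

text \<open>The list of all elements spans the field over its prime subfield; thinning it out
  yields the basis.\<close>
lemma (in field) finite_field_structure:
  assumes fin: "finite (carrier R)"
  obtains p n :: nat and h where "normalization_semidom_class.prime p" "n \<ge> 1"
    and "card (carrier R) = p ^ n"
    and "add_monoid R \<cong> Zp_power p n"
    and "h \<in> ring_hom (residue_ring (int p)) R"
proof -
  obtain p :: nat and h where p: "normalization_semidom_class.prime p"
    and h: "h \<in> ring_hom (residue_ring (int p)) R"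
    using finite_field_prime_hom[OF fin] by blast
  let ?Z = "residue_ring (int p)"
  interpret Z: field ?Z
    using field_residue_ring[OF p] .
  interpret H: ring_hom_ring ?Z R h
    using ring_hom_ringI2[OF Z.ring_axioms ring_axioms h] .
  have inj: "inj_on h (carrier ?Z)"
    using non_trivial_field_hom_is_inj[OF h Z.field_axioms field_axioms] .
  have sub: "subfield (h ` carrier ?Z) R"
    using H.img_is_subfield(2)[OF Z.carrier_is_subfield] by simp
  obtain xs where xs: "set xs = carrier R"
    using fin finite_list by blast
  hence xs_sub: "set xs \<subseteq> carrier R"
    by simp
  obtain Us where Us: "set Us \<subseteq> carrier R" "independent (h ` carrier ?Z) Us"
    "Span (h ` carrier ?Z) Us = Span (h ` carrier ?Z) xs"
    by (rule filter_base[OF sub xs_sub])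
  have "Span (h ` carrier ?Z) Us = carrier R"
    using Span_base_incl[OF sub xs_sub] Span_in_carrier[OF subfieldE(3)[OF sub] xs_sub] xs Us(3)
    by (intro subset_antisym) simp_all
  from coordinates_iso[OF h inj sub Us(2) this]
  have iso: "Zp_power p (length Us) \<cong> add_monoid R" .
  have "group (Zp_power p (length Us))"
    unfolding Zp_power_def by (rule product_group) (rule Z.a_group)
  from group.iso_sym[OF this iso] have iso': "add_monoid R \<cong> Zp_power p (length Us)" .
  have card: "card (carrier R) = p ^ length Us"
    using iso_same_card[OF iso] by (simp add: card_Zp_power)
  have "length Us \<noteq> 0"
  proof
    assume "length Us = 0"
    hence "card (carrier R) = 1"
      using card by simp
    then obtain x where "carrier R = {x}"
      using card_1_singletonE by blast
    hence "\<zero> = \<one>"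
      using zero_closed one_closed by (metis singletonD)
    thus False by simp
  qed
  hence "length Us \<ge> 1" by linarith
  from that[OF p this card iso' h] show thesis .
qed

lemma (in field) finite_field_card:
  assumes "finite (carrier R)"
  shows "\<exists>p r :: nat. normalization_semidom_class.prime p \<and> r \<ge> 1 \<and> card (carrier R) = p ^ r"
  by (rule finite_field_structure[OF assms]) blast

lemma (in field) finite_field_additive:
  assumes "finite (carrier R)" "normalization_semidom_class.prime (p :: nat)" "r \<ge> 1"
    and "card (carrier R) = p ^ r"
  shows "add_monoid R \<cong> Zp_power p r"
proof -
  obtain p' n :: nat where n: "normalization_semidom_class.prime p'" "n \<ge> 1"
    "card (carrier R) = p' ^ n" "add_monoid R \<cong> Zp_power p' n"
    by (rule finite_field_structure[OF assms(1)])
  have "p' ^ n = p ^ r"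
    using n(3) assms(4) by argo
  hence "p' = p" "n = r"
    using prime_power_inj'[OF n(1) assms(2)] n(2) assms(3) by auto
  thus ?thesis
    using n(4) by blast
qed

section \<open>The multiplicative group\<close>

lemma (in field) finite_field_power_card:
  assumes fin: "finite (carrier R)" and x: "x \<in> carrier R"
  shows "x [^] card (carrier R) = x"
proof (cases "x = \<zero>")
  case True
  have "card (carrier R) \<noteq> 0"
    using fin x by auto
  thus ?thesis
    using True by (simp add: nat_pow_zero)
next
  case False
  \<comment> \<open>Lagrange's theorem in the multiplicative group.\<close>
  have "x [^]\<^bsub>Multiplicative_Group.mult_of R\<^esub> order (Multiplicative_Group.mult_of R) = \<one>\<^bsub>Multiplicative_Group.mult_of R\<^esub>"
    using group.pow_order_eq_1[OF field_mult_group, of x] x False fin by simp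
  hence "x [^] (card (carrier R) - 1) = \<one>"
    using fin by (simp add: order_mult_of Multiplicative_Group.nat_pow_mult_of order_def)
  hence "x [^] Suc (card (carrier R) - 1) = x"
    using x by simp
  moreover have "card (carrier R) > 0"
    using fin x card_gt_0_iff by blast
  ultimately show ?thesis
    by simp
qed

lemma (in field) finite_field_mult_cyclic:
  assumes fin: "finite (carrier R)"
  shows "cyclic_group (Multiplicative_Group.mult_of R)"
proof -
  interpret M: group "Multiplicative_Group.mult_of R"
    by (rule field_mult_group)
  obtain a where a: "a \<in> carrier (Multiplicative_Group.mult_of R)" "carrier (Multiplicative_Group.mult_of R) = {a [^] i | i::nat. i \<in> UNIV}"
    using finite_field_mult_group_has_gen[OF fin] by blast
  have "carrier (Multiplicative_Group.mult_of R) \<subseteq> range (\<lambda>n::int. a [^]\<^bsub>Multiplicative_Group.mult_of R\<^esub> n)"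
  proof
    fix x assume "x \<in> carrier (Multiplicative_Group.mult_of R)"
    then obtain i :: nat where "x = a [^] i"
      using a(2) by blast
    hence "x = a [^]\<^bsub>Multiplicative_Group.mult_of R\<^esub> int i"
      by (simp add: Multiplicative_Group.nat_pow_mult_of int_pow_int)
    thus "x \<in> range (\<lambda>n::int. a [^]\<^bsub>Multiplicative_Group.mult_of R\<^esub> n)"
      by blast
  qed
  moreover have "range (\<lambda>n::int. a [^]\<^bsub>Multiplicative_Group.mult_of R\<^esub> n) \<subseteq> carrier (Multiplicative_Group.mult_of R)"
    using M.int_pow_closed[OF a(1)] by blast
  ultimately show ?thesis
    using a(1) unfolding M.cyclic_group by blast
qed

section \<open>The Frobenius map in characteristic p\<close>

text \<open>Pascal's rule, with the two shifted sums written separately: \<open>?u\<close> is the sum for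
  \<open>x \<otimes> (x \<oplus> y) [^] n\<close> and \<open>?v\<close> the one for \<open>y \<otimes> (x \<oplus> y) [^] n\<close>.\<close>
lemma (in cring) binomial_theorem:
  assumes x: "x \<in> carrier R" and y: "y \<in> carrier R"
  shows "(x \<oplus> y) [^] n =
    (\<Oplus>k\<in>{..n}. add_pow R (n choose k) (x [^] k \<otimes> y [^] (n - k)))"
proof (induct n)
  case 0
  thus ?case by simp
next
  case (Suc n)
  let ?B = "\<Oplus>k\<in>{..n}. add_pow R (n choose k) (x [^] k \<otimes> y [^] (n - k))"
  let ?u = "\<lambda>k. add_pow R (n choose k) (x [^] Suc k \<otimes> y [^] (n - k))"
  let ?v = "\<lambda>k. add_pow R (n choose k) (x [^] k \<otimes> y [^] (Suc n - k))"
  let ?w = "\<lambda>k. add_pow R (Suc n choose k) (x [^] k \<otimes> y [^] (Suc n - k))"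
  have xB: "x \<otimes> ?B = (\<Oplus>k\<in>{..n}. ?u k)"
    using x y by (subst finsum_rdistr) (auto simp: add_pow_rdistr m_ac intro!: finsum_cong')
  have yB: "y \<otimes> ?B = (\<Oplus>k\<in>{..n}. ?v k)"
    using x y by (subst finsum_rdistr) (auto simp: add_pow_rdistr m_ac Suc_diff_le intro!: finsum_cong')
  \<comment> \<open>The added term is zero, as \<open>n choose Suc n = 0\<close>; it permits splitting off \<open>?v 0\<close> instead.\<close>
  have "(\<Oplus>k\<in>{..n}. ?v k) = (\<Oplus>k\<in>{..Suc n}. ?v k)"
    using x y by (subst finsum_Suc) (auto simp: binomial_eq_0 finsum_closed)
  also have "\<dots> = (\<Oplus>k\<in>{..n}. ?v (Suc k)) \<oplus> ?v 0"
    using x y by (subst finsum_Suc2) auto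
  finally have v: "(\<Oplus>k\<in>{..n}. ?v k) = (\<Oplus>k\<in>{..n}. ?v (Suc k)) \<oplus> ?v 0" .
  have "(\<Oplus>k\<in>{..Suc n}. ?w k) = (\<Oplus>k\<in>{..n}. ?w (Suc k)) \<oplus> ?w 0"
    using x y by (subst finsum_Suc2) auto
  also have "(\<Oplus>k\<in>{..n}. ?w (Suc k)) = (\<Oplus>k\<in>{..n}. ?u k \<oplus> ?v (Suc k))"
    using x y by (intro finsum_cong') (auto simp: add.nat_pow_mult)
  also have "\<dots> = (\<Oplus>k\<in>{..n}. ?u k) \<oplus> (\<Oplus>k\<in>{..n}. ?v (Suc k))"
    using x y by (intro finsum_addf) auto
  finally have "(\<Oplus>k\<in>{..Suc n}. ?w k) = (\<Oplus>k\<in>{..n}. ?u k) \<oplus> (\<Oplus>k\<in>{..n}. ?v k)"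
    unfolding v using x y by (simp add: a_assoc finsum_closed)
  also have "\<dots> = x \<otimes> ?B \<oplus> y \<otimes> ?B"
    by (simp only: xB yB)
  also have "\<dots> = ?B \<otimes> (x \<oplus> y)"
    using x y by (simp add: l_distr[symmetric] m_comm)
  finally show ?case
    using Suc by simp
qed

text \<open>Characteristic \<open>p\<close> is expressed by one equation, so that it passes along any ring
  homomorphism, in particular to polynomial rings and to field extensions.\<close>
locale prime_char_cring = cring +
  fixes p :: nat
  assumes p_prime: "normalization_semidom_class.prime p"
    and p_one: "add_pow R p \<one> = \<zero>"
begin

lemma add_pow_multiple:
  assumes "p dvd n" "z \<in> carrier R"
  shows "add_pow R n z = \<zero>"
proof -
  obtain c where c: "n = p * c"
    using assms(1) by blast
  have "add_pow R n z = add_pow R n \<one> \<otimes> z"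
    using assms(2) by (simp add: add_pow_ldistr)
  also have "add_pow R n \<one> = add_pow R c (add_pow R p \<one>)"
    by (simp add: c add.nat_pow_pow)
  finally show ?thesis
    using assms(2) by (simp add: p_one)
qed

text \<open>The inner binomial coefficients of a prime row are divisible by \<open>p\<close>.\<close>
lemma frobenius_add:
  assumes "x \<in> carrier R" "y \<in> carrier R"
  shows "(x \<oplus> y) [^] p = x [^] p \<oplus> y [^] p"
proof -
  let ?w = "\<lambda>k. add_pow R (p choose k) (x [^] k \<otimes> y [^] (p - k))"
  have "p \<ge> 2"
    using p_prime prime_ge_2_nat by blast
  then obtain m where m: "p = Suc (Suc m)"
    by (metis add_2_eq_Suc le_Suc_ex)
  have zero: "?w k = \<zero>" if "k \<noteq> 0" "k < p" for k
    using that assms p_prime by (intro add_pow_multiple dvd_choose_prime) auto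
  have "(x \<oplus> y) [^] p = (\<Oplus>k\<in>{..Suc (Suc m)}. ?w k)"
    unfolding binomial_theorem[OF assms] using m by simp
  also have "\<dots> = ?w (Suc (Suc m)) \<oplus> ((\<Oplus>k\<in>{..m}. ?w (Suc k)) \<oplus> ?w 0)"
    using assms by (subst finsum_Suc, force, subst finsum_Suc2) auto
  also have "(\<Oplus>k\<in>{..m}. ?w (Suc k)) = \<zero>"
    by (intro add.finprod_one_eqI zero) (auto simp: m)
  also have "?w (Suc (Suc m)) = x [^] p"
    using assms m by simp
  also have "?w 0 = y [^] p"
    using assms by simp
  finally show ?thesis
    using assms by simp
qed

lemma frobenius_power_add:
  assumes "x \<in> carrier R" "y \<in> carrier R"
  shows "(x \<oplus> y) [^] (p ^ r) = x [^] (p ^ r) \<oplus> y [^] (p ^ r)"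
proof (induct r)
  case (Suc r)
  have "z [^] (p ^ Suc r) = (z [^] (p ^ r)) [^] p" if "z \<in> carrier R" for z
    using that by (simp add: nat_pow_pow mult.commute)
  thus ?case
    using Suc assms by (simp add: frobenius_add)
qed (use assms in simp)

lemma frobenius_power_uminus:
  assumes "x \<in> carrier R"
  shows "(\<ominus> x) [^] (p ^ r) = \<ominus> (x [^] (p ^ r))"
proof -
  have "p ^ r \<noteq> 0"
    using p_prime by (simp add: prime_gt_0_nat)
  hence "(\<ominus> x) [^] (p ^ r) \<oplus> x [^] (p ^ r) = \<zero>"
    using frobenius_power_add[of "\<ominus> x" x r] assms by (simp add: l_neg nat_pow_zero)
  thus ?thesis
    using assms minus_equality by simp
qed

lemma frobenius_power_minus:
  assumes "x \<in> carrier R" "y \<in> carrier R"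
  shows "(x \<ominus> y) [^] (p ^ r) = x [^] (p ^ r) \<ominus> y [^] (p ^ r)"
  using assms by (simp add: a_minus_def frobenius_power_add frobenius_power_uminus)

lemma hom_image_char:
  assumes "cring S" "h \<in> ring_hom R S"
  shows "prime_char_cring S p"
proof -
  interpret S: cring S by fact
  have "h (add_pow R n \<one>) = add_pow S n \<one>\<^bsub>S\<^esub>" for n :: nat
  proof (induct n)
    case 0
    thus ?case using ring_hom_zero[OF assms(2) ring_axioms S.ring_axioms] by simp
  qed (simp add: ring_hom_memE[OF assms(2)])
  from this[of p] have "add_pow S p \<one>\<^bsub>S\<^esub> = \<zero>\<^bsub>S\<^esub>"
    using ring_hom_zero[OF assms(2) ring_axioms S.ring_axioms] p_one by simp
  thus ?thesis
    by unfold_locales (rule p_prime)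
qed

end

lemma (in field) frobenius_fixed_subfield:
  assumes "prime_char_cring R p"
  shows "subfield {x \<in> carrier R. x [^] (p ^ r) = x} R"
proof (rule subfieldI')
  interpret prime_char_cring R p by fact
  let ?S = "{x \<in> carrier R. x [^] (p ^ r) = x}"
  show "subring ?S R"
    by (rule subringI)
      (auto simp: frobenius_power_uminus frobenius_power_add nat_pow_distrib)
  fix k assume k: "k \<in> ?S - {\<zero>}"
  hence unit: "k \<in> Units R"
    by (simp add: field_Units)
  have "k \<otimes> (inv k) [^] (p ^ r) = k [^] (p ^ r) \<otimes> (inv k) [^] (p ^ r)"
    using k by simp
  also have "\<dots> = (k \<otimes> inv k) [^] (p ^ r)"
    by (subst nat_pow_distrib) (use k unit in auto)
  also have "\<dots> = \<one>"
    using unit by simp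
  finally show "inv k \<in> ?S"
    using comm_inv_char[of k "inv k [^] (p ^ r)"] k unit by simp
qed

section \<open>The roots of the polynomial with fixed points of a power map\<close>

text \<open>Its roots are the fixed points of \<open>x \<mapsto> x ^ n\<close>.\<close>
definition (in ring) fixpoly :: "nat \<Rightarrow> 'a list"
  where "fixpoly n = X [^]\<^bsub>poly_ring R\<^esub> n \<ominus>\<^bsub>poly_ring R\<^esub> X"

context domain
begin

lemma fixpoly_closed: "fixpoly n \<in> carrier (poly_ring R)"
proof -
  interpret UP: domain "poly_ring R"
    using univ_poly_is_domain[OF carrier_is_subring] .
  show ?thesis
    using var_closed(1)[OF carrier_is_subring] unfolding fixpoly_def by simp
qed

lemma degree_fixpoly:
  assumes "n \<ge> 2"
  shows "degree (fixpoly n) = n"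
proof -
  interpret UP: domain "poly_ring R"
    using univ_poly_is_domain[OF carrier_is_subring] .
  have X: "X \<in> carrier (poly_ring R)" "degree X = 1"
    using var_closed(1)[OF carrier_is_subring] by (auto simp: var_def)
  have deg: "degree (X [^]\<^bsub>poly_ring R\<^esub> n) = n" "degree (\<ominus>\<^bsub>poly_ring R\<^esub> X) = 1"
    using polynomial_pow_degree[OF X(1), of n] univ_poly_a_inv_degree[OF carrier_is_subring X(1)] X(2)
    by simp_all
  have "polynomial (carrier R) (X [^]\<^bsub>poly_ring R\<^esub> n)" "polynomial (carrier R) (\<ominus>\<^bsub>poly_ring R\<^esub> X)"
    using X(1) unfolding univ_poly_carrier by simp_all
  from poly_add_degree_eq[OF carrier_is_subring this] deg assms show ?thesis
    unfolding fixpoly_def a_minus_def univ_poly_add by simp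
qed

lemma eval_fixpoly:
  assumes "a \<in> carrier R"
  shows "eval (fixpoly n) a = a [^] n \<ominus> a"
proof -
  interpret UP: domain "poly_ring R"
    using univ_poly_is_domain[OF carrier_is_subring] .
  interpret E: ring_hom_ring "poly_ring R" R "\<lambda>f. eval f a"
    using eval_ring_hom[OF carrier_is_subring assms] .
  have X: "X \<in> carrier (poly_ring R)"
    using var_closed(1)[OF carrier_is_subring] .
  show ?thesis
    using X by (simp add: fixpoly_def a_minus_def E.hom_nat_pow eval_var[OF assms])
qed

lemma is_root_fixpoly:
  assumes "n \<ge> 2"
  shows "is_root (fixpoly n) a \<longleftrightarrow> a \<in> carrier R \<and> a [^] n = a"
proof -
  have "fixpoly n \<noteq> []"
    using degree_fixpoly[OF assms] assms by auto
  moreover have "a [^] n \<ominus> a = \<zero> \<longleftrightarrow> a [^] n = a" if "a \<in> carrier R"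
    using that by simp
  ultimately show ?thesis
    by (auto simp: is_root_def eval_fixpoly)
qed

text \<open>Separability is seen by translating the root to zero: with \<open>q = p ^ r\<close> and \<open>l = X - a\<close> for a root \<open>a\<close>, additivity of
  the \<open>q\<close>-th power in the polynomial ring and \<open>a ^ q = a\<close> give \<open>X ^ q - X = l ^ q - l\<close>. If \<open>l ^ 2\<close> divided
  this, it would divide \<open>l\<close>.\<close>
lemma alg_mult_fixpoly:
  assumes "prime_char_cring R p" "r \<ge> 1"
  shows "alg_mult (fixpoly (p ^ r)) a \<le> 1"
proof (rule ccontr)
  interpret prime_char_cring R p by fact
  interpret UP: domain "poly_ring R"
    using univ_poly_is_domain[OF carrier_is_subring] .
  let ?U = "poly_ring R" and ?q = "p ^ r"
  let ?l = "[\<one>, \<ominus> a]"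
  have hom: "poly_of_const \<in> ring_hom R ?U"
    using canonical_embedding_is_hom[OF carrier_is_subring] by simp
  interpret UPc: prime_char_cring "poly_ring R" p
    using hom_image_char[OF UP.is_cring hom] .
  have q: "?q \<ge> 2"
    using prime_ge_2_nat[OF p_prime] assms(2) self_le_power[of p r] by linarith
  assume "\<not> alg_mult (fixpoly ?q) a \<le> 1"
  hence mult: "2 \<le> alg_mult (fixpoly ?q) a"
    by simp
  hence a: "a \<in> carrier R" "a [^] ?q = a"
    using alg_mult_gt_zero_iff_is_root[OF fixpoly_closed, of ?q a] is_root_fixpoly[OF q] by auto
  define c where "c = poly_of_const a"
  have c: "c \<in> carrier ?U"
    using ring_hom_memE(1)[OF hom a(1)] by (simp add: c_def)
  interpret H: ring_hom_ring R ?U poly_of_const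
    using ring_hom_ringI2[OF ring_axioms UP.ring_axioms hom] .
  have cq: "c [^]\<^bsub>?U\<^esub> ?q = c"
    using a by (simp add: c_def H.hom_nat_pow[symmetric])
  have X: "X \<in> carrier ?U"
    using var_closed(1)[OF carrier_is_subring] .
  have l: "?l \<in> carrier ?U"
    using a unfolding sym[OF univ_poly_carrier] polynomial_def by simp
  \<comment> \<open>The zero polynomial is the empty list, hence the two forms of the constant \<open>a\<close>.\<close>
  have "c = (if a = \<zero> then [] else [a])"
    by (simp add: c_def poly_of_const_def)
  hence "?l = X \<ominus>\<^bsub>?U\<^esub> c"
    using a c univ_poly_a_inv_def'[OF carrier_is_subring c]
    by (simp add: a_minus_def univ_poly_add var_def)
  hence "?l [^]\<^bsub>?U\<^esub> ?q \<ominus>\<^bsub>?U\<^esub> ?l = (X [^]\<^bsub>?U\<^esub> ?q \<ominus>\<^bsub>?U\<^esub> c) \<ominus>\<^bsub>?U\<^esub> (X \<ominus>\<^bsub>?U\<^esub> c)"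
    using UPc.frobenius_power_minus[OF X c] cq by simp
  also have "\<dots> = fixpoly ?q"
    unfolding fixpoly_def using X c UP.nat_pow_closed[OF X, of ?q] by algebra
  finally have f: "fixpoly ?q = ?l [^]\<^bsub>?U\<^esub> ?q \<ominus>\<^bsub>?U\<^esub> ?l" ..
  have sq: "?l [^]\<^bsub>?U\<^esub> (2::nat) divides\<^bsub>?U\<^esub> fixpoly ?q"
    using le_alg_mult_imp_pdivides[OF a(1) fixpoly_closed mult] by (simp add: pdivides_def)
  have sq': "?l [^]\<^bsub>?U\<^esub> (2::nat) divides\<^bsub>?U\<^esub> ?l [^]\<^bsub>?U\<^esub> ?q"
    using UP.nat_pow_mult[OF l, of 2 "?q - 2"] q l
    by (metis UP.nat_pow_closed dividesI le_add_diff_inverse)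
  obtain g where g: "g \<in> carrier ?U" "fixpoly ?q = ?l [^]\<^bsub>?U\<^esub> (2::nat) \<otimes>\<^bsub>?U\<^esub> g"
    using sq by (auto simp: factor_def)
  obtain k where k: "k \<in> carrier ?U" "?l [^]\<^bsub>?U\<^esub> ?q = ?l [^]\<^bsub>?U\<^esub> (2::nat) \<otimes>\<^bsub>?U\<^esub> k"
    using sq' by (auto simp: factor_def)
  have l2: "?l [^]\<^bsub>?U\<^esub> (2::nat) \<in> carrier ?U"
    using l by simp
  have "?l = ?l [^]\<^bsub>?U\<^esub> ?q \<ominus>\<^bsub>?U\<^esub> (?l [^]\<^bsub>?U\<^esub> ?q \<ominus>\<^bsub>?U\<^esub> ?l)"
    using l UP.nat_pow_closed[OF l, of ?q] by algebra
  also have "\<dots> = ?l [^]\<^bsub>?U\<^esub> (2::nat) \<otimes>\<^bsub>?U\<^esub> k \<ominus>\<^bsub>?U\<^esub> ?l [^]\<^bsub>?U\<^esub> (2::nat) \<otimes>\<^bsub>?U\<^esub> g"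
    using f g(2) k(2) by simp
  also have "\<dots> = ?l [^]\<^bsub>?U\<^esub> (2::nat) \<otimes>\<^bsub>?U\<^esub> (k \<ominus>\<^bsub>?U\<^esub> g)"
    using l2 g(1) k(1) by algebra
  finally have "?l [^]\<^bsub>?U\<^esub> (2::nat) pdivides ?l"
    unfolding pdivides_def using g(1) k(1) by (metis UP.minus_closed dividesI)
  from pdivides_imp_degree_le[OF carrier_is_subring l2 l _ this] show False
    using polynomial_pow_degree[OF l, of 2] by simp
qed

end

lemma (in algebraically_closed) card_frobenius_fixed:
  assumes "prime_char_cring L p" "r \<ge> 1"
  shows "finite {x \<in> carrier L. x [^] (p ^ r) = x}" "card {x \<in> carrier L. x [^] (p ^ r) = x} = p ^ r"
proof -
  let ?q = "p ^ r" and ?S = "{x \<in> carrier L. x [^] (p ^ r) = x}"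
  interpret prime_char_cring L p by fact
  have q: "?q \<ge> 2"
    using prime_ge_2_nat[OF p_prime] assms(2) self_le_power[of p r] by linarith
  have S: "set_mset (roots (fixpoly ?q)) = ?S"
    using roots_mem_iff_is_root[OF fixpoly_closed] is_root_fixpoly[OF q] by auto
  show "finite ?S"
    unfolding S[symmetric] by simp
  have "count (roots (fixpoly ?q)) x = 1" if "x \<in># roots (fixpoly ?q)" for x
    using that alg_mult_fixpoly[OF assms, of x] count_greater_zero_iff[of "roots (fixpoly ?q)" x]
    unfolding alg_mult_eq_count_roots[OF fixpoly_closed] by linarith
  hence "size (roots (fixpoly ?q)) = card ?S"
    unfolding S[symmetric] by (simp add: size_multiset_overloaded_eq)
  thus "card ?S = ?q"
    using roots_over_carrier[OF fixpoly_closed, of ?q] degree_fixpoly[OF q]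
    by (simp add: splitted_def)
qed

section \<open>Existence\<close>

lemma prime_char_residue_ring:
  assumes p: "normalization_semidom_class.prime (p::nat)"
  shows "prime_char_cring (residue_ring (int p)) p"
proof -
  let ?Z = "residue_ring (int p)"
  interpret Z: field ?Z
    using field_residue_ring[OF p] .
  have "add_pow ?Z n \<one>\<^bsub>?Z\<^esub> = int n mod int p" for n :: nat
  proof (induct n)
    case (Suc n)
    have "add_pow ?Z (Suc n) \<one>\<^bsub>?Z\<^esub> = add_pow ?Z n \<one>\<^bsub>?Z\<^esub> \<oplus>\<^bsub>?Z\<^esub> \<one>\<^bsub>?Z\<^esub>"
      by simp
    also have "\<dots> = int (Suc n) mod int p"
      unfolding Suc by (simp add: residue_ring_def mod_simps add.commute)
    finally show ?case .
  next
    case 0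
    have "add_pow ?Z (0::nat) \<one>\<^bsub>?Z\<^esub> = \<zero>\<^bsub>?Z\<^esub>"
      by simp
    thus ?case
      by (simp only: residue_ring_def ring.simps of_nat_0 mod_0)
  qed
  from this[of p] show ?thesis
    by unfold_locales (simp_all add: p residue_ring_def)
qed

lemma finite_field_exists:
  assumes p: "normalization_semidom_class.prime (p::nat)" and r: "r \<ge> 1"
  shows "\<exists>R :: nat ring. field R \<and> finite (carrier R) \<and> card (carrier R) = p ^ r"
proof -
  let ?Z = "residue_ring (int p)"
  interpret Z: field ?Z
    using field_residue_ring[OF p] .
  interpret Zp: prime_char_cring ?Z p
    using prime_char_residue_ring[OF p] .
  define L where "L = Z.alg_closure"
  interpret L: algebraic_closure L "Z.indexed_const ` carrier ?Z"
    using Z.alg_closureE(1) by (simp add: L_def)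
  have char: "prime_char_cring L p"
    using Zp.hom_image_char[OF L.is_cring] Z.alg_closureE(2) by (simp add: L_def)
  let ?S = "{x \<in> carrier L. x [^]\<^bsub>L\<^esub> (p ^ r) = x}"
  have fin: "finite ?S" and card: "card ?S = p ^ r"
    using L.card_frobenius_fixed[OF char r] by auto
  interpret S: field "L\<lparr>carrier := ?S\<rparr>"
    using L.subfield_iff(2)[OF L.frobenius_fixed_subfield[OF char]] .
  \<comment> \<open>Any injection serves to transport the structure.\<close>
  obtain f :: "_ \<Rightarrow> nat" where f: "inj_on f ?S"
    using finite_imp_inj_to_nat_seg[OF fin] by blast
  let ?R = "image_ring f (L\<lparr>carrier := ?S\<rparr>)"
  have "field ?R"
    using S.inj_imp_image_ring_is_field f by simp
  moreover have "carrier ?R = f ` ?S"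
    by (simp add: image_ring_carrier)
  ultimately show ?thesis
    using fin card card_image[OF f] by (intro exI[of _ ?R]) simp
qed

section \<open>Extending a homomorphism to polynomials\<close>

context ring_hom_ring
begin

text \<open>Lists represent polynomials only without leading zeros; injectivity of \<open>h\<close> ensures that
  applying it to the coefficients creates none and so commutes with normalization.\<close>
lemma map_normalize:
  assumes "inj_on h (carrier R)" "set p \<subseteq> carrier R"
  shows "map h (R.normalize p) = normalize (map h p)"
  using assms(2)
proof (induct p)
  case (Cons a p)
  hence "h a = \<zero>\<^bsub>S\<^esub> \<longleftrightarrow> a = \<zero>"
    using assms(1) inj_onD[OF assms(1), of a "\<zero>"] by auto
  thus ?case
    using Cons by simp
qed simp

lemma map_poly_add:
  assumes "inj_on h (carrier R)" "set p \<subseteq> carrier R" "set q \<subseteq> carrier R"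
  shows "map h (R.poly_add p q) = poly_add (map h p) (map h q)"
proof -
  have aux: "map h (R.poly_add p q) = poly_add (map h p) (map h q)"
    if "length p \<ge> length q" "set p \<subseteq> carrier R" "set q \<subseteq> carrier R" for p q
  proof -
    have "map h (map2 (\<oplus>) xs ys) = map2 (\<oplus>\<^bsub>S\<^esub>) (map h xs) (map h ys)
      \<and> set (map2 (\<oplus>) xs ys) \<subseteq> carrier R"
      if "set xs \<subseteq> carrier R" "set ys \<subseteq> carrier R" for xs ys
      using that by (induct xs ys rule: list_induct2') auto
    moreover have "set (replicate (length p - length q) \<zero> @ q) \<subseteq> carrier R"
      using that by auto
    ultimately have sums: "map h (map2 (\<oplus>) p (replicate (length p - length q) \<zero> @ q)) =
        map2 (\<oplus>\<^bsub>S\<^esub>) (map h p) (map h (replicate (length p - length q) \<zero> @ q))"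
      "set (map2 (\<oplus>) p (replicate (length p - length q) \<zero> @ q)) \<subseteq> carrier R"
      using that(2) by blast+
    show ?thesis
      using that(1) sums(1) by (simp add: map_normalize[OF assms(1) sums(2)] del: map_map)
  qed
  show ?thesis
  proof (cases "length p \<ge> length q")
    case True
    thus ?thesis using aux assms by blast
  next
    case False
    hence "length p \<le> length q" by simp
    thus ?thesis using False aux[of p q] assms aux[of q p] by simp
  qed
qed

lemma map_poly_mult:
  assumes "inj_on h (carrier R)" "set p \<subseteq> carrier R" "set q \<subseteq> carrier R"
  shows "map h (R.poly_mult p q) = poly_mult (map h p) (map h q)"
  using assms(2)
proof (induct p)
  case (Cons a p)
  have "map h (map ((\<otimes>) a) q) = map ((\<otimes>\<^bsub>S\<^esub>) (h a)) (map h q)"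
    using Cons(2) assms(3) by auto
  moreover have "set (map ((\<otimes>) a) q @ replicate (degree (a # p)) \<zero>) \<subseteq> carrier R"
    using Cons(2) assms(3) by auto
  moreover have "set (R.poly_mult p q) \<subseteq> carrier R"
    using Cons(2) assms(3) R.poly_mult_in_carrier by auto
  ultimately show ?case
    using Cons by (simp add: map_poly_add[OF assms(1)] del: R.poly_add.simps poly_add.simps map_map)
qed simp

lemma map_poly_ring_hom:
  assumes "inj_on h (carrier R)"
  shows "map h \<in> ring_hom (poly_ring R) (poly_ring S)"
proof (rule ring_hom_memI)
  have coeffs: "set p \<subseteq> carrier R" if "p \<in> carrier (poly_ring R)" for p
    using that R.polynomial_incl univ_poly_carrier by blast
  fix p q assume p: "p \<in> carrier (poly_ring R)" and q: "q \<in> carrier (poly_ring R)"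
  have "lead_coeff p \<in> carrier R" if "p \<noteq> []"
    using coeffs[OF p] hd_in_set[OF that] by blast
  hence "p \<noteq> [] \<Longrightarrow> h (lead_coeff p) \<noteq> \<zero>\<^bsub>S\<^esub>"
    using p inj_onD[OF assms, of "lead_coeff p" \<zero>]
    unfolding sym[OF univ_poly_carrier] polynomial_def by auto
  thus "map h p \<in> carrier (poly_ring S)"
    using coeffs[OF p] unfolding sym[OF univ_poly_carrier] polynomial_def
    by (auto simp: hd_map)
  show "map h (p \<oplus>\<^bsub>poly_ring R\<^esub> q) = map h p \<oplus>\<^bsub>poly_ring S\<^esub> map h q"
    using map_poly_add[OF assms coeffs[OF p] coeffs[OF q]] by (simp add: univ_poly_add)
  show "map h (p \<otimes>\<^bsub>poly_ring R\<^esub> q) = map h p \<otimes>\<^bsub>poly_ring S\<^esub> map h q"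
    using map_poly_mult[OF assms coeffs[OF p] coeffs[OF q]] by (simp add: univ_poly_mult)
qed (simp add: univ_poly_one)

end

section \<open>Uniqueness\<close>

text \<open>Elements of \<open>F\<close> are lifted to \<open>P\<close> along \<open>e\<close> and then mapped by \<open>e'\<close>; the inclusion of
  kernels makes the result independent of the lift.\<close>
lemma ring_hom_factor:
  assumes "ring P" "ring F" "ring K"
    and e: "e \<in> ring_hom P F" "e ` carrier P = carrier F" and e': "e' \<in> ring_hom P K"
    and ker: "\<And>f. f \<in> carrier P \<Longrightarrow> e f = \<zero>\<^bsub>F\<^esub> \<Longrightarrow> e' f = \<zero>\<^bsub>K\<^esub>"
  shows "\<exists>\<psi>. \<psi> \<in> ring_hom F K"
proof -
  interpret E: ring_hom_ring P F e
    using ring_hom_ringI2[OF assms(1,2) e(1)] .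
  interpret E': ring_hom_ring P K e'
    using ring_hom_ringI2[OF assms(1,3) e'] .
  define s where "s = inv_into (carrier P) e"
  have s: "s x \<in> carrier P" "e (s x) = x" if "x \<in> carrier F" for x
    using that inv_into_into[of x e "carrier P"] f_inv_into_f[of x e "carrier P"] e(2)
    by (simp_all add: s_def)
  have eq: "e' f = e' g" if "f \<in> carrier P" "g \<in> carrier P" "e f = e g" for f g
  proof -
    have "e (f \<ominus>\<^bsub>P\<^esub> g) = \<zero>\<^bsub>F\<^esub>"
      using that by (simp add: a_minus_def E.S.r_neg)
    hence "e' (f \<ominus>\<^bsub>P\<^esub> g) = \<zero>\<^bsub>K\<^esub>"
      using that ker by simp
    hence "e' f \<ominus>\<^bsub>K\<^esub> e' g = \<zero>\<^bsub>K\<^esub>"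
      using that by (simp add: a_minus_def)
    thus ?thesis
      using that by simp
  qed
  have "(\<lambda>x. e' (s x)) \<in> ring_hom F K"
  proof (rule ring_hom_memI)
    fix x y assume xy: "x \<in> carrier F" "y \<in> carrier F"
    show "e' (s x) \<in> carrier K"
      using s xy by simp
    have "e' (s (x \<otimes>\<^bsub>F\<^esub> y)) = e' (s x \<otimes>\<^bsub>P\<^esub> s y)"
      using s xy by (intro eq) auto
    thus "e' (s (x \<otimes>\<^bsub>F\<^esub> y)) = e' (s x) \<otimes>\<^bsub>K\<^esub> e' (s y)"
      using s xy by simp
    have "e' (s (x \<oplus>\<^bsub>F\<^esub> y)) = e' (s x \<oplus>\<^bsub>P\<^esub> s y)"
      using s xy by (intro eq) auto
    thus "e' (s (x \<oplus>\<^bsub>F\<^esub> y)) = e' (s x) \<oplus>\<^bsub>K\<^esub> e' (s y)"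
      using s xy by simp
  next
    have "e' (s \<one>\<^bsub>F\<^esub>) = e' \<one>\<^bsub>P\<^esub>"
      using s by (intro eq) auto
    thus "e' (s \<one>\<^bsub>F\<^esub>) = \<one>\<^bsub>K\<^esub>"
      by simp
  qed
  thus ?thesis by blast
qed

text \<open>Two fields of the same cardinality are compared through polynomials over the field \<open>Z\<close>
  that embeds into both; each polynomial is evaluated in an extension \<open>R\<close> by way of the embedding \<open>h\<close>.\<close>
locale field_extension_hom = Z: field Z + R: field R + ring_hom_ring Z R h
  for Z :: "('a, 'm) ring_scheme" and R :: "('b, 'n) ring_scheme" (structure) and h
begin

definition ext_eval :: "'b \<Rightarrow> 'a list \<Rightarrow> 'b"
  where "ext_eval a f = R.eval (map h f) a"

lemma h_inj: "inj_on h (carrier Z)"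
  using non_trivial_field_hom_is_inj[OF homh Z.field_axioms R.field_axioms] .

lemma ext_eval_hom:
  assumes "a \<in> carrier R"
  shows "ext_eval a \<in> ring_hom (poly_ring Z) R"
proof -
  have "ext_eval a = (\<lambda>f. R.eval f a) \<circ> map h"
    by (simp add: ext_eval_def fun_eq_iff)
  thus ?thesis
    using ring_hom_trans[OF map_poly_ring_hom[OF h_inj] R.eval_is_hom[OF R.carrier_is_subring assms]]
    by simp
qed

lemma ext_eval_var:
  assumes "a \<in> carrier R"
  shows "ext_eval a X\<^bsub>Z\<^esub> = a"
  using assms by (simp add: ext_eval_def var_def)

lemma ext_eval_fixpoly:
  assumes "a \<in> carrier R"
  shows "ext_eval a (Z.fixpoly n) = a [^] n \<ominus> a"
proof -
  interpret UP: domain "poly_ring Z"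
    using Z.univ_poly_is_domain[OF Z.carrier_is_subring] .
  interpret E: ring_hom_ring "poly_ring Z" R "ext_eval a"
    using ring_hom_ringI2[OF UP.ring_axioms R.ring_axioms ext_eval_hom[OF assms]] .
  show ?thesis
    using Z.var_closed(1)[OF Z.carrier_is_subring]
    by (simp add: Z.fixpoly_def a_minus_def E.hom_nat_pow ext_eval_var[OF assms])
qed

lemma root_count_le_degree:
  assumes g: "g \<in> carrier (poly_ring Z)" "g \<noteq> []"
    and zero: "\<And>b. b \<in> carrier R \<Longrightarrow> ext_eval b g = \<zero>"
  shows "card (carrier R) \<le> degree g"
proof -
  have G: "map h g \<in> carrier (poly_ring R)"
    using ring_hom_memE(1)[OF map_poly_ring_hom[OF h_inj] g(1)] .
  have "set_mset (R.roots (map h g)) = carrier R"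
    using R.roots_mem_iff_is_root[OF G] zero g(2) by (auto simp: R.is_root_def ext_eval_def)
  hence "card (carrier R) = size (mset_set (set_mset (R.roots (map h g))))"
    by simp
  also have "\<dots> \<le> size (R.roots (map h g))"
    by (intro size_mset_mono mset_set_set_mset_msubset)
  also have "\<dots> \<le> degree (map h g)"
    using R.size_roots_le_degree[OF G] .
  finally show ?thesis
    by simp
qed

end

text \<open>The homomorphism sends a generator \<open>a\<close> of the multiplicative group of \<open>F\<close> to a root in \<open>K\<close> of
  the minimal polynomial \<open>m\<close> of \<open>a\<close>.\<close>
lemma finite_fields_hom:
  fixes F :: "('c, 'd) ring_scheme" and K :: "('e, 'f) ring_scheme"
  assumes F: "field_extension_hom Z F h" and K: "field_extension_hom Z K h'"
    and fin: "finite (carrier F)" "finite (carrier K)" and card: "card (carrier F) = card (carrier K)"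
  shows "\<exists>\<psi>. \<psi> \<in> ring_hom F K"
proof -
  interpret F: field_extension_hom Z F h by fact
  interpret K: field_extension_hom Z K h' by fact
  interpret UP: domain "poly_ring Z"
    using F.Z.univ_poly_is_domain[OF F.Z.carrier_is_subring] .
  let ?U = "poly_ring Z" and ?q = "card (carrier F)"
  obtain a where a: "a \<in> carrier (Multiplicative_Group.mult_of F)" "carrier (Multiplicative_Group.mult_of F) = {a [^]\<^bsub>F\<^esub> i | i::nat. i \<in> UNIV}"
    using F.R.finite_field_mult_group_has_gen[OF fin(1)] by blast
  have aF: "a \<in> carrier F"
    using a(1) by simp
  interpret E: ring_hom_ring ?U F "F.ext_eval a"
    using ring_hom_ringI2[OF UP.ring_axioms F.R.ring_axioms F.ext_eval_hom[OF aF]] .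
  have X: "X\<^bsub>Z\<^esub> \<in> carrier ?U"
    using F.Z.var_closed(1)[OF F.Z.carrier_is_subring] .
  have surj: "F.ext_eval a ` carrier ?U = carrier F"
  proof
    show "carrier F \<subseteq> F.ext_eval a ` carrier ?U"
    proof
      fix x assume x: "x \<in> carrier F"
      show "x \<in> F.ext_eval a ` carrier ?U"
      proof (cases "x = \<zero>\<^bsub>F\<^esub>")
        case True
        thus ?thesis
          using E.hom_zero UP.zero_closed by (metis imageI)
      next
        case False
        hence "x \<in> carrier (Multiplicative_Group.mult_of F)"
          using x by simp
        then obtain i :: nat where "x = a [^]\<^bsub>F\<^esub> i"
          using a(2) by blast
        hence "x = F.ext_eval a (X\<^bsub>Z\<^esub> [^]\<^bsub>?U\<^esub> i)"
          using X by (simp add: E.hom_nat_pow F.ext_eval_var[OF aF])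
        thus ?thesis
          using X by blast
      qed
    qed
  qed auto
  have "{\<zero>\<^bsub>F\<^esub>, \<one>\<^bsub>F\<^esub>} \<subseteq> carrier F"
    by simp
  hence q: "?q \<ge> 2"
    using card_mono[OF fin(1), of "{\<zero>\<^bsub>F\<^esub>, \<one>\<^bsub>F\<^esub>}"] by simp
  let ?f = "F.Z.fixpoly ?q" and ?J = "a_kernel ?U F (F.ext_eval a)"
  have f: "?f \<in> carrier ?U" "degree ?f = ?q"
    using F.Z.fixpoly_closed F.Z.degree_fixpoly[OF q] by auto
  hence f_nz: "?f \<noteq> []"
    using q by auto
  have "F.ext_eval a ?f = \<zero>\<^bsub>F\<^esub>"
    using F.ext_eval_fixpoly[OF aF] F.R.finite_field_power_card[OF fin(1) aF] aF by simp
  hence fJ: "?f \<in> ?J"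
    using f(1) unfolding a_kernel_def' by blast
  hence "?J \<noteq> {[]}"
    using f_nz by blast
  then obtain m where m: "m \<in> carrier ?U" "lead_coeff m = \<one>\<^bsub>Z\<^esub>" "?J = PIdl\<^bsub>?U\<^esub> m"
    using F.Z.exists_unique_gen[OF F.Z.carrier_is_subfield E.kernel_is_ideal] by blast
  obtain g where g: "g \<in> carrier ?U" "?f = g \<otimes>\<^bsub>?U\<^esub> m"
    using fJ unfolding m(3) cgenideal_def by blast
  have nz: "g \<noteq> []" "m \<noteq> []"
    using g f_nz m(1) UP.l_null UP.r_null by (auto simp: univ_poly_zero)
  have deg: "degree g + degree m = ?q"
    using F.Z.poly_mult_degree_eq[OF F.Z.carrier_is_subring, of g m] g m(1) nz f(2)
    by (simp add: univ_poly_carrier univ_poly_mult)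
  have "\<exists>b\<in>carrier K. K.ext_eval b m = \<zero>\<^bsub>K\<^esub>"
  proof (rule ccontr)
    assume no_root: "\<not> (\<exists>b\<in>carrier K. K.ext_eval b m = \<zero>\<^bsub>K\<^esub>)"
    have "K.ext_eval b g = \<zero>\<^bsub>K\<^esub>" if b: "b \<in> carrier K" for b
    proof -
      have "K.ext_eval b ?f = \<zero>\<^bsub>K\<^esub>"
        using K.ext_eval_fixpoly[OF b] K.R.finite_field_power_card[OF fin(2) b] b card by simp
      hence "K.ext_eval b g \<otimes>\<^bsub>K\<^esub> K.ext_eval b m = \<zero>\<^bsub>K\<^esub>"
        using ring_hom_memE(2)[OF K.ext_eval_hom[OF b] g(1) m(1)] g(2) by simp
      thus ?thesis
        using K.R.integral ring_hom_memE(1)[OF K.ext_eval_hom[OF b]] g(1) m(1) no_root b by blast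
    qed
    \<comment> \<open>Otherwise the cofactor \<open>g\<close> has fewer than \<open>|K|\<close> roots. A monic constant is \<open>1\<close>, which is not
    in a kernel.\<close>
    hence "degree m = 0"
      using K.root_count_le_degree[OF g(1) nz(1)] deg card by simp
    hence "m = \<one>\<^bsub>?U\<^esub>"
      using m(2) nz(2) by (cases m) (auto simp: univ_poly_one)
    hence "F.ext_eval a m = \<one>\<^bsub>F\<^esub>"
      using E.hom_one by simp
    moreover have "m \<in> ?J"
      unfolding m(3) by (rule UP.cgenideal_self[OF m(1)])
    hence "F.ext_eval a m = \<zero>\<^bsub>F\<^esub>"
      unfolding a_kernel_def' by blast
    ultimately show False
      by simp
  qed
  then obtain b where b: "b \<in> carrier K" "K.ext_eval b m = \<zero>\<^bsub>K\<^esub>"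
    by blast
  have "K.ext_eval b f = \<zero>\<^bsub>K\<^esub>" if "f \<in> carrier ?U" "F.ext_eval a f = \<zero>\<^bsub>F\<^esub>" for f
  proof -
    have "f \<in> ?J"
      using that unfolding a_kernel_def' by blast
    then obtain g where "g \<in> carrier ?U" "f = g \<otimes>\<^bsub>?U\<^esub> m"
      unfolding m(3) cgenideal_def by blast
    thus ?thesis
      using ring_hom_memE(1,2)[OF K.ext_eval_hom[OF b(1)]] m(1) b(2) by simp
  qed
  from ring_hom_factor[OF UP.ring_axioms F.R.ring_axioms K.R.ring_axioms
      F.ext_eval_hom[OF aF] surj K.ext_eval_hom[OF b(1)] this]
  show ?thesis .
qed

lemma finite_fields_iso:
  assumes F: "field F" "finite (carrier F)" and K: "field K" "finite (carrier K)"
    and card: "card (carrier F) = card (carrier K)"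
  shows "F \<simeq> K"
proof -
  interpret F: field F by fact
  interpret K: field K by fact
  obtain p n h where p: "normalization_semidom_class.prime (p::nat)" "n \<ge> 1" "card (carrier F) = p ^ n"
    "h \<in> ring_hom (residue_ring (int p)) F"
    by (rule F.finite_field_structure[OF F(2)])
  obtain p' n' h' where p': "normalization_semidom_class.prime (p'::nat)" "n' \<ge> 1" "card (carrier K) = p' ^ n'"
    "h' \<in> ring_hom (residue_ring (int p')) K"
    by (rule K.finite_field_structure[OF K(2)])
  have "p = p'"
    using prime_power_inj'(1)[OF p(1) p'(1), of n n'] p p' card by simp
  interpret Z: field "residue_ring (int p)"
    using field_residue_ring[OF p(1)] .
  have "field_extension_hom (residue_ring (int p)) F h"
    by (intro field_extension_hom.intro Z.field_axioms F.field_axioms ring_hom_ringI2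
        Z.ring_axioms F.ring_axioms p(4))
  moreover have "field_extension_hom (residue_ring (int p)) K h'"
    using p'(4) unfolding \<open>p = p'\<close>[symmetric]
    by (intro field_extension_hom.intro Z.field_axioms K.field_axioms ring_hom_ringI2
        Z.ring_axioms K.ring_axioms)
  ultimately obtain \<psi> where \<psi>: "\<psi> \<in> ring_hom F K"
    using finite_fields_hom F(2) K(2) card by blast
  have inj: "inj_on \<psi> (carrier F)"
    using non_trivial_field_hom_is_inj[OF \<psi> F(1) K(1)] .
  have "\<psi> ` carrier F \<subseteq> carrier K"
    using ring_hom_memE(1)[OF \<psi>] by blast
  hence "\<psi> ` carrier F = carrier K"
    using card_subset_eq[OF K(2)] card_image[OF inj] card by simp
  thus ?thesis
    using \<psi> inj unfolding is_ring_iso_def ring_iso_def bij_betw_def by blast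
qed

section \<open>Classification of finite fields\<close>

theorem mainTheorem1:
  shows
    "(\<forall>q>0. (\<exists>R :: nat ring. field R \<and> finite (carrier R) \<and> card (carrier R) = q) \<longleftrightarrow>
            (\<exists>p r :: nat. normalization_semidom_class.prime p \<and> r \<ge> 1 \<and> q = p ^ r)) \<and>
     (\<forall>q>0. \<forall>R :: ('a, 'b) ring_scheme.
        field R \<and> finite (carrier R) \<and> card (carrier R) = q \<longrightarrow>
          (\<exists>p r :: nat. normalization_semidom_class.prime p \<and> r \<ge> 1 \<and> q = p ^ r)) \<and>
     (\<forall>(F :: ('c, 'd) ring_scheme) (K :: ('e, 'f) ring_scheme).
        field F \<and> field K \<and> finite (carrier F) \<and> finite (carrier K) \<and>
        card (carrier F) = card (carrier K) \<longrightarrow> F \<simeq> K) \<and>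
     (\<forall>(F :: ('g, 'h) ring_scheme) (p :: nat) (r :: nat).
        field F \<and> finite (carrier F) \<and> normalization_semidom_class.prime p \<and> r \<ge> 1 \<and> card (carrier F) = p ^ r \<longrightarrow>
          add_monoid F \<cong> Zp_power p r \<and> cyclic_group (Multiplicative_Group.mult_of F))"
proof (intro conjI allI impI)
  fix q :: nat
  show "(\<exists>R :: nat ring. field R \<and> finite (carrier R) \<and> card (carrier R) = q) \<longleftrightarrow>
    (\<exists>p r :: nat. normalization_semidom_class.prime p \<and> r \<ge> 1 \<and> q = p ^ r)"
    using field.finite_field_card finite_field_exists by blast
next
  fix q :: nat and R :: "('a, 'b) ring_scheme"
  assume "field R \<and> finite (carrier R) \<and> card (carrier R) = q"
  thus "\<exists>p r :: nat. normalization_semidom_class.prime p \<and> r \<ge> 1 \<and> q = p ^ r"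
    using field.finite_field_card by blast
next
  fix F :: "('c, 'd) ring_scheme" and K :: "('e, 'f) ring_scheme"
  assume "field F \<and> field K \<and> finite (carrier F) \<and> finite (carrier K) \<and>
    card (carrier F) = card (carrier K)"
  thus "F \<simeq> K"
    by (intro finite_fields_iso) auto
next
  fix F :: "('g, 'h) ring_scheme" and p r :: nat
  assume F: "field F \<and> finite (carrier F) \<and> normalization_semidom_class.prime p \<and> r \<ge> 1 \<and>
    card (carrier F) = p ^ r"
  thus "add_monoid F \<cong> Zp_power p r" "cyclic_group (Multiplicative_Group.mult_of F)"
    using field.finite_field_additive field.finite_field_mult_cyclic by blast+
qed

end
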